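(* Suppose a platoon of vehicles $n=0,1,2,\dots$ is in the steady compounding oscillation case, that is, $$x_n(t)=v_et-nx_e+\sum_{m=1}^M A_m|G(j\omega_m)|^n\sin\bigl(\omega_mt+\phi_m+n\angle G(j\omega_m)\bigr),$$ $$v_n(t)=v_e+\sum_{m=1}^M A_m|G(j\omega_m)|^n\,\omega_m\cos\bigl(\omega_mt+\phi_m+n\angle G(j\omega_m)\bigr),$$ where $$G(s)=\frac{k_s+k_vs}{s^2+k_s\tau^* s+k_vs}.$$ For $n\ge 1$ let $W_{n-1\to n}(t)=v_{n-1}(t)-k_v\,[x_{n-1}(t)-x_n(t)]$ be the wave speed from vehicle $n-1$ to vehicle $n$. Then: (1) The wave speed $W_{n-1\to n}(t)$ consists of two components: a nominal part, $v_e-k_vx_e$, and an oscillatory part. The oscillatory part is the sum over $m=1,\dots,M$ of the oscillatory parts of the single oscillation cases, the $m$-th single oscillation case being the one in which only the $m$-th sinusoid (with $A_m,\omega_m,\phi_m$) is present in the motion. (2) If the frequencies $\omega_1,\dots,\omega_M$ are rationally related, then the period of the wave speed oscillations is the least common multiple of $T_m=2\pi/\omega_m$, $1\le m\le M$.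
   Context: The vehicles are in the congested regime, in which the Adaptive Cruise Control (ACC) of each vehicle is active with constant feedback gains $k_s>0$ (spacing deviation) and $k_v>0$ (speed difference); $\tau^*$ is the desired constant time headway. $x_n(t)$ and $v_n(t)$ are the position and speed of vehicle $n$, where vehicle $n-1$ is the immediate leader of vehicle $n$ and vehicle $0$ leads the platoon. $v_e$ is the equilibrium speed and $x_e$ the equilibrium spacing. The motion of vehicle $0$ is the nominal motion $v_et$ plus an oscillation decomposed by a Fourier transform into $M$ sinusoidal waves, where $A_m$, $\omega_m>0$ and $\phi_m$ are the amplitude, angular frequency and phase shift of the $m$-th wave. $G(s)=X_n(s)/X_{n-1}(s)$ is the transfer function from the position of vehicle $n-1$ to that of vehicle $n$, taken to be the function displayed in the claim; $j$ is the imaginary unit. Its norm and phase shift at $s=j\omega$ are $$|G(j\omega)|=\frac{\sqrt{\bigl(-k_s+k_v(k_s\tau^*+k_v)\bigr)^2\omega^2+\bigl[k_s(k_s\tau^*+k_v)+k_v\omega^2\bigr]^2}}{\omega\bigl[(k_s\tau^*+k_v)^2+\omega^2\bigr]},$$ $$\angle G(j\omega)=\tan^{-1}\!\left(\frac{k_s(k_s\tau^*+k_v)+k_v\omega^2}{\omega\,[k_s-k_v(k_s\tau^*+k_v)]}\right).$$ The frequencies are rationally related if every ratio $\omega_i/\omega_k$ is a ratio of two integers. The least common multiple of positive reals $T_1,\dots,T_M$ with pairwise rational ratios is the smallest $T>0$ that is a positive integer multiple of every $T_m$.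
   Formalization: In (2), that the least common multiple is the least period is claimed only for pairwise distinct frequencies ω_m and nonzero amplitudes A_m (otherwise waves may vanish or cancel and the claim fails); the desired time headway τ* is taken positive and M ≥ 1. *)

theory Defs
  imports "HOL-Analysis.Analysis"
begin

definition acc_transfer :: "real \<Rightarrow> real \<Rightarrow> real \<Rightarrow> complex \<Rightarrow> complex" where
  "acc_transfer ks kv \<tau> s =
     (of_real ks + of_real kv * s) /
     (s^2 + of_real ks * of_real \<tau> * s + of_real kv * s)"

(* alpha is a value of the multivalued inverse tangent of N / D, the quotient being infinite
   if D = 0. No branch is selected: the principal value of arctan differs by pi from the
   argument of G(j omega) when ks > kv (ks tau + kv), and N / D is not a number when
   ks = kv (ks tau + kv). *)
definition is_phase_shift :: "real \<Rightarrow> real \<Rightarrow> real \<Rightarrow> real \<Rightarrow> real \<Rightarrow> bool" where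
  "is_phase_shift ks kv \<tau> \<omega> \<alpha> \<longleftrightarrow>
     (let N = ks * (ks * \<tau> + kv) + kv * \<omega>^2;
          D = \<omega> * (ks - kv * (ks * \<tau> + kv))
      in if D = 0 then cos \<alpha> = 0 else cos \<alpha> \<noteq> 0 \<and> tan \<alpha> = N / D)"

(* I is the set of indices of the waves that are present: {1..M} in the compounding case,
   {m} in the m-th single oscillation case. ang w stands for the phase shift of G(j w). *)
definition osc_position ::
  "(complex \<Rightarrow> complex) \<Rightarrow> (real \<Rightarrow> real) \<Rightarrow> (nat \<Rightarrow> real) \<Rightarrow> (nat \<Rightarrow> real) \<Rightarrow> (nat \<Rightarrow> real)
    \<Rightarrow> nat set \<Rightarrow> nat \<Rightarrow> real \<Rightarrow> real" where
  "osc_position G ang A \<omega> \<phi> I n t =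
     (\<Sum>m\<in>I. A m * cmod (G (\<i> * of_real (\<omega> m))) ^ n
             * sin (\<omega> m * t + \<phi> m + real n * ang (\<omega> m)))"

definition osc_velocity ::
  "(complex \<Rightarrow> complex) \<Rightarrow> (real \<Rightarrow> real) \<Rightarrow> (nat \<Rightarrow> real) \<Rightarrow> (nat \<Rightarrow> real) \<Rightarrow> (nat \<Rightarrow> real)
    \<Rightarrow> nat set \<Rightarrow> nat \<Rightarrow> real \<Rightarrow> real" where
  "osc_velocity G ang A \<omega> \<phi> I n t =
     (\<Sum>m\<in>I. A m * cmod (G (\<i> * of_real (\<omega> m))) ^ n * \<omega> m
             * cos (\<omega> m * t + \<phi> m + real n * ang (\<omega> m)))"

definition steady_oscillation ::
  "(complex \<Rightarrow> complex) \<Rightarrow> (real \<Rightarrow> real) \<Rightarrow> real \<Rightarrow> real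
    \<Rightarrow> (nat \<Rightarrow> real) \<Rightarrow> (nat \<Rightarrow> real) \<Rightarrow> (nat \<Rightarrow> real) \<Rightarrow> nat set
    \<Rightarrow> (nat \<Rightarrow> real \<Rightarrow> real) \<Rightarrow> (nat \<Rightarrow> real \<Rightarrow> real) \<Rightarrow> bool" where
  "steady_oscillation G ang ve xe A \<omega> \<phi> I x v \<longleftrightarrow>
     (\<forall>n t. x n t = ve * t - real n * xe + osc_position G ang A \<omega> \<phi> I n t) \<and>
     (\<forall>n t. v n t = ve + osc_velocity G ang A \<omega> \<phi> I n t)"

(* Wave speed from vehicle n - 1 to vehicle n; meaningful for n \<ge> 1 only. *)
definition wave_speed ::
  "real \<Rightarrow> (nat \<Rightarrow> real \<Rightarrow> real) \<Rightarrow> (nat \<Rightarrow> real \<Rightarrow> real) \<Rightarrow> nat \<Rightarrow> real \<Rightarrow> real" where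
  "wave_speed kv x v n t = v (n - 1) t - kv * (x (n - 1) t - x n t)"

(* The wave speed is linear in the motion; this is the part contributed by the sinusoids
   present in the motion, the nominal motion contributing the rest. *)
definition wave_speed_osc ::
  "real \<Rightarrow> (complex \<Rightarrow> complex) \<Rightarrow> (real \<Rightarrow> real)
    \<Rightarrow> (nat \<Rightarrow> real) \<Rightarrow> (nat \<Rightarrow> real) \<Rightarrow> (nat \<Rightarrow> real) \<Rightarrow> nat set \<Rightarrow> nat \<Rightarrow> real \<Rightarrow> real" where
  "wave_speed_osc kv G ang A \<omega> \<phi> I =
     wave_speed kv (osc_position G ang A \<omega> \<phi> I) (osc_velocity G ang A \<omega> \<phi> I)"

definition rationally_related :: "nat set \<Rightarrow> (nat \<Rightarrow> real) \<Rightarrow> bool" where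
  "rationally_related I \<omega> \<longleftrightarrow> (\<forall>i\<in>I. \<forall>k\<in>I. \<omega> i / \<omega> k \<in> \<rat>)"

definition common_multiple :: "nat set \<Rightarrow> (nat \<Rightarrow> real) \<Rightarrow> real \<Rightarrow> bool" where
  "common_multiple I T L \<longleftrightarrow> 0 < L \<and> (\<forall>m\<in>I. \<exists>k::nat. 0 < k \<and> L = real k * T m)"

definition least_common_multiple :: "nat set \<Rightarrow> (nat \<Rightarrow> real) \<Rightarrow> real \<Rightarrow> bool" where
  "least_common_multiple I T L \<longleftrightarrow>
     common_multiple I T L \<and> (\<forall>L'. common_multiple I T L' \<longrightarrow> L \<le> L')"

definition is_period :: "(real \<Rightarrow> real) \<Rightarrow> real \<Rightarrow> bool" where
  "is_period f T \<longleftrightarrow> 0 < T \<and> (\<forall>t. f (t + T) = f t)"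

definition fundamental_period :: "(real \<Rightarrow> real) \<Rightarrow> real \<Rightarrow> bool" where
  "fundamental_period f T \<longleftrightarrow> is_period f T \<and> (\<forall>T'. is_period f T' \<longrightarrow> T \<le> T')"

lemma acc_transfer_rect:
  assumes "0 < \<omega>"
  shows "acc_transfer ks kv \<tau> (\<i> * of_real \<omega>) =
    Complex ((- ks + kv * (ks * \<tau> + kv)) * \<omega>) (- (ks * (ks * \<tau> + kv) + kv * \<omega>^2)) /
    of_real (\<omega> * ((ks * \<tau> + kv)^2 + \<omega>^2))"
proof -
  define a where "a = ks * \<tau> + kv"
  have pos: "0 < \<omega> * (a^2 + \<omega>^2)"
    using assms by (intro mult_pos_pos add_nonneg_pos) auto
  have eq: "acc_transfer ks kv \<tau> (\<i> * of_real \<omega>) =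
      Complex ks (kv * \<omega>) / Complex (- (\<omega>^2)) (a * \<omega>)"
    unfolding acc_transfer_def
    by (intro arg_cong2[where f = "(/)"])
       (simp_all add: complex_eq_iff a_def power2_eq_square algebra_simps)
  have nz: "Complex (- (\<omega>^2)) (a * \<omega>) \<noteq> 0"
    using assms by (simp add: complex_eq_iff)
  have nz': "complex_of_real (\<omega> * (a^2 + \<omega>^2)) \<noteq> 0"
    using pos by (metis less_irrefl of_real_eq_0_iff)
  have "Complex ks (kv * \<omega>) * complex_of_real (\<omega> * (a^2 + \<omega>^2)) =
     Complex ((- ks + kv * a) * \<omega>) (- (ks * a + kv * \<omega>^2)) * Complex (- (\<omega>^2)) (a * \<omega>)"
    by (simp add: complex_eq_iff power2_eq_square algebra_simps)
  then show ?thesis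
    using frac_eq_eq[OF nz nz'] unfolding eq a_def[symmetric] by blast
qed

lemma cmod_acc_transfer:
  assumes "0 < \<omega>"
  shows "cmod (acc_transfer ks kv \<tau> (\<i> * of_real \<omega>)) =
    sqrt ((- ks + kv * (ks * \<tau> + kv))^2 * \<omega>^2 + (ks * (ks * \<tau> + kv) + kv * \<omega>^2)^2) /
    (\<omega> * ((ks * \<tau> + kv)^2 + \<omega>^2))"
proof -
  have "0 < \<omega> * ((ks * \<tau> + kv)^2 + \<omega>^2)"
    using assms by (intro mult_pos_pos add_nonneg_pos) auto
  then show ?thesis
    unfolding acc_transfer_rect[OF assms] norm_divide norm_of_real
    by (simp add: cmod_def power_mult_distrib power2_commute del: of_real_mult of_real_add)
       (simp add: power2_eq_square algebra_simps)
qed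

lemma is_phase_shift_Arg:
  assumes "0 < \<omega>" "0 < ks" "0 < kv" "0 < \<tau>"
  shows "is_phase_shift ks kv \<tau> \<omega> (Arg (acc_transfer ks kv \<tau> (\<i> * of_real \<omega>)))"
proof -
  define N where "N = ks * (ks * \<tau> + kv) + kv * \<omega>^2"
  define D where "D = \<omega> * (ks - kv * (ks * \<tau> + kv))"
  define R where "R = \<omega> * ((ks * \<tau> + kv)^2 + \<omega>^2)"
  define z where "z = acc_transfer ks kv \<tau> (\<i> * of_real \<omega>)"
  have R: "0 < R" unfolding R_def using assms by (intro mult_pos_pos add_nonneg_pos) auto
  have N: "0 < N" unfolding N_def using assms by (intro add_pos_pos mult_pos_pos) auto
  have "z = Complex (- D) (- N) / of_real R"
    unfolding z_def acc_transfer_rect[OF assms(1)] D_def N_def R_def by (simp add: algebra_simps)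
  then have re: "Re z = - D / R" and im: "Im z = - N / R" by simp_all
  then have z0: "z \<noteq> 0" using N R by auto
  have c: "cos (Arg z) = - D / R / cmod z" and s: "sin (Arg z) = - N / R / cmod z"
    using z0 re im by (simp_all add: cos_Arg sin_Arg)
  show ?thesis
    unfolding is_phase_shift_def Let_def N_def[symmetric] D_def[symmetric] z_def[symmetric]
  proof (cases "D = 0")
    case True
    then show "if D = 0 then cos (Arg z) = 0 else cos (Arg z) \<noteq> 0 \<and> tan (Arg z) = N / D"
      using c by simp
  next
    case False
    then show "if D = 0 then cos (Arg z) = 0 else cos (Arg z) \<noteq> 0 \<and> tan (Arg z) = N / D"
      using z0 R unfolding tan_def c s by simp
  qed
qed

lemma is_phase_shift_arctan:
  assumes "\<omega> * (ks - kv * (ks * \<tau> + kv)) \<noteq> 0"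
  shows "is_phase_shift ks kv \<tau> \<omega>
    (arctan ((ks * (ks * \<tau> + kv) + kv * \<omega>^2) / (\<omega> * (ks - kv * (ks * \<tau> + kv)))))"
  using assms unfolding is_phase_shift_def Let_def by (simp add: tan_arctan)

end

theory Submission
  imports Defs
begin

text \<open>
  Each wave contributes \<open>Re (c\<^sub>m * cis (\<omega>\<^sub>m t))\<close> to the wave speed. If all
  \<open>c\<^sub>m\<close> are nonzero and the frequencies are distinct, linear independence of the waves
  shows that a period of the sum is a period of each wave, hence a common multiple of the
  \<open>T\<^sub>m\<close>. The coefficient \<open>c\<^sub>m\<close> vanishes only if
  \<open>r * cis \<alpha> = 1 - \<i> \<omega> / kv\<close> with \<open>r\<close> the gain and \<open>\<alpha>\<close> the phase shift;
  on either branch of the inverse tangent the phase then forces \<open>ks < \<omega>\<^sup>2\<close>, whereas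
  the modulus forces \<open>ks > \<omega>\<^sup>2\<close>.
\<close>

section \<open>Linear independence of waves with distinct frequencies\<close>

lemma Re_mult_cis_eq_0_imp:
  fixes w :: real
  assumes "0 < w" and zero: "\<And>t. Re (c * cis (w * t)) = 0"
  shows "c = 0"
proof -
  have "Re c = 0" using zero[of 0] by simp
  \<comment> \<open>At this time the wave has phase \<open>pi / 2\<close>, so \<open>cis\<close>
    equals \<open>\<i>\<close> and the real part becomes \<open>- Im c\<close>.\<close>
  moreover have "Im c = 0" using zero[of "pi / 2 / w"] assms(1) by simp
  ultimately show ?thesis by (simp add: complex_eq_iff)
qed

text \<open>The symmetric shift \<open>f (t + h) + f (t - h)\<close> multiplies a wave of frequency
  \<open>w\<close> by the real number \<open>2 * cos (w * h)\<close>. Choosing \<open>h\<close> so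
  that two frequencies get different multipliers separates them, and the induction discards one wave
  at a time.\<close>

lemma sum_Re_mult_cis_eq_0_imp:
  fixes w :: "'a \<Rightarrow> real"
  assumes "finite I" "inj_on w I" "\<And>i. i \<in> I \<Longrightarrow> 0 < w i"
    and "\<And>t. (\<Sum>i\<in>I. Re (c i * cis (w i * t))) = 0" and "i \<in> I"
  shows "c i = 0"
  using assms
proof (induction I arbitrary: c i rule: finite_induct)
  case empty
  then show ?case by simp
next
  case (insert k I)
  let ?F = "\<lambda>i t. Re (c i * cis (w i * t))"
  have shift: "?F i (t + h) + ?F i (t - h) = 2 * cos (w i * h) * ?F i t" for i t h
    by (simp add: ring_distribs cos_add cos_diff sin_add sin_diff)
  have rest: "c j = 0" if j: "j \<in> I" for j
  proof -
    have pos: "0 < w j" "0 < w k" and ne: "w j \<noteq> w k"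
      using insert j by (auto simp: inj_on_def)
    \<comment> \<open>The angles \<open>w j * h\<close> and \<open>w k * h\<close> then sum to
      \<open>pi\<close>, so both lie between 0 and \<open>pi\<close>, where the cosine is injective;
      this makes \<open>d j\<close> nonzero.\<close>
    define h where "h = pi / (w j + w k)"
    define d where "d i = 2 * (cos (w i * h) - cos (w k * h))" for i
    \<comment> \<open>The combination \<open>f (t + h) + f (t - h) - 2 cos (w\<^sub>k h) f t\<close> removes the \<open>k\<close>-th wave.\<close>
    have "(\<Sum>i\<in>I. Re ((of_real (d i) * c i) * cis (w i * t))) = 0" for t
    proof -
      have "(\<Sum>i\<in>I. Re ((of_real (d i) * c i) * cis (w i * t)))
          = (\<Sum>i\<in>insert k I. d i * ?F i t)"
        using insert.hyps by (simp add: d_def algebra_simps)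
      also have "\<dots> = (\<Sum>i\<in>insert k I. ?F i (t + h) + ?F i (t - h) - 2 * cos (w k * h) * ?F i t)"
        unfolding shift d_def by (simp only: algebra_simps)
      also have "\<dots> = (\<Sum>i\<in>insert k I. ?F i (t + h)) + (\<Sum>i\<in>insert k I. ?F i (t - h))
          - 2 * cos (w k * h) * (\<Sum>i\<in>insert k I. ?F i t)"
        by (simp only: sum.distrib sum_subtractf sum_distrib_left)
      also have "\<dots> = 0"
        unfolding insert.prems(3) by simp
      finally show ?thesis .
    qed
    then have "of_real (d j) * c j = 0"
      using insert.IH[where c = "\<lambda>i. of_real (d i) * c i"] insert.prems j by simp
    moreover have "d j \<noteq> 0"
    proof
      assume "d j = 0"
      then have "cos (w j * h) = cos (w k * h)" by (simp add: d_def)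
      moreover have "0 \<le> w j * h" "w j * h \<le> pi" "0 \<le> w k * h" "w k * h \<le> pi"
        using pos by (simp_all add: h_def field_simps)
      ultimately have "w j * h = w k * h" using cos_inj_pi by blast
      then show False using ne pos by (simp add: h_def)
    qed
    ultimately show ?thesis by simp
  qed
  have "Re (c k * cis (w k * t)) = 0" for t
    using insert.prems(3)[of t] insert.hyps rest by simp
  then have "c k = 0"
    using Re_mult_cis_eq_0_imp[of "w k" "c k"] insert.prems(2) by blast
  then show ?case using rest insert.prems(4) by blast
qed

section \<open>Periods of sums of waves\<close>

lemma cis_eq_1_imp_multiple:
  fixes w T :: real
  assumes "0 < w" "0 < T" "cis (w * T) = 1"
  shows "\<exists>k::nat. 0 < k \<and> T = real k * (2 * pi / w)"
proof -
  have "cos (w * T) = 1" using assms(3) by (simp add: complex_eq_iff)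
  then obtain n :: int where n: "w * T = of_int n * 2 * pi"
    unfolding cos_one_2pi_int by blast
  have "0 < of_int n * (2 * pi)" using n assms by (metis mult.assoc mult_pos_pos)
  then have "0 < n" by (simp add: zero_less_mult_iff)
  moreover have "T = of_int n * (2 * pi / w)" using n assms by (simp add: field_simps)
  ultimately show ?thesis by (intro exI[of _ "nat n"]) simp
qed

lemma is_period_sum_waves:
  assumes "common_multiple I (\<lambda>i. 2 * pi / w i) L" "\<And>i. i \<in> I \<Longrightarrow> 0 < w i"
  shows "is_period (\<lambda>t. \<Sum>i\<in>I. Re (c i * cis (w i * t))) L"
  unfolding is_period_def
proof (intro conjI allI sum.cong refl)
  show "0 < L" using assms by (simp add: common_multiple_def)
next
  fix t i assume i: "i \<in> I"
  then obtain k :: nat where "L = real k * (2 * pi / w i)"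
    using assms by (auto simp: common_multiple_def)
  then have "w i * (t + L) = w i * t + 2 * pi * real k"
    using assms(2)[OF i] by (simp add: field_simps)
  then have "cis (w i * (t + L)) = cis (w i * t) * cis (2 * pi * real k)"
    by (simp only: cis_mult)
  also have "cis (2 * pi * real k) = 1" by (simp add: cis_multiple_2pi)
  finally show "Re (c i * cis (w i * (t + L))) = Re (c i * cis (w i * t))" by simp
qed

text \<open>The difference of the sum at \<open>t + T\<close> and at \<open>t\<close> is a
  combination of the same waves with coefficients \<open>c i * (cis (w i * T) - 1)\<close>. It
  vanishes identically, so independence forces \<open>cis (w i * T) = 1\<close> for every
  wave.\<close>

lemma period_sum_waves_imp_common_multiple:
  assumes "finite I" "inj_on w I" and pos: "\<And>i. i \<in> I \<Longrightarrow> 0 < w i"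
    and nz: "\<And>i. i \<in> I \<Longrightarrow> c i \<noteq> 0"
    and per: "is_period (\<lambda>t. \<Sum>i\<in>I. Re (c i * cis (w i * t))) T"
  shows "common_multiple I (\<lambda>i. 2 * pi / w i) T"
  unfolding common_multiple_def
proof (intro conjI ballI)
  show T: "0 < T" using per by (simp add: is_period_def)
  fix i assume i: "i \<in> I"
  have "(\<Sum>i\<in>I. Re ((c i * (cis (w i * T) - 1)) * cis (w i * t))) = 0" for t
  proof -
    have "(c i * (cis (w i * T) - 1)) * cis (w i * t) = c i * cis (w i * (t + T)) - c i * cis (w i * t)"
      for i
      by (simp add: ring_distribs cis_mult[symmetric] mult_ac)
    then show ?thesis
      using per by (simp add: is_period_def sum_subtractf del: times_complex.sel)
  qed
  then have "c i * (cis (w i * T) - 1) = 0"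
    using sum_Re_mult_cis_eq_0_imp[where c = "\<lambda>i. c i * (cis (w i * T) - 1)"] assms(1,2) pos i
    by blast
  then have "cis (w i * T) = 1" using nz[OF i] by simp
  then show "\<exists>k::nat. 0 < k \<and> T = real k * (2 * pi / w i)"
    using cis_eq_1_imp_multiple pos[OF i] T by blast
qed

section \<open>Least common multiples of positive reals with rational ratios\<close>

lemma positive_rational_multiple:
  fixes a b :: real
  assumes "0 < a" "0 < b" "a / b \<in> \<rat>"
  shows "\<exists>p q :: nat. 0 < p \<and> 0 < q \<and> real p * b = real q * a"
proof -
  have "a / b \<noteq> 0" using assms by simp
  then obtain p q :: nat where "q \<noteq> 0" "\<bar>a / b\<bar> = real p / real q"
    using Rats_abs_nat_div_natE[OF assms(3)] by metis
  then have "real p * b = real q * a" using assms by (simp add: field_simps)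
  moreover from this have "0 < p" using assms \<open>q \<noteq> 0\<close> by (cases p) auto
  ultimately show ?thesis using \<open>q \<noteq> 0\<close> by blast
qed

text \<open>Every common multiple is a natural multiple of one fixed \<open>T a\<close>, so
  minimality reduces to the well-ordering of the naturals once some common multiple is
  known.\<close>

lemma least_common_multiple_exists:
  assumes "finite I" "I \<noteq> {}" and pos: "\<And>i. i \<in> I \<Longrightarrow> 0 < T i"
    and rat: "\<And>i j. i \<in> I \<Longrightarrow> j \<in> I \<Longrightarrow> T i / T j \<in> \<rat>"
  shows "\<exists>L. least_common_multiple I T L"
proof -
  obtain a where a: "a \<in> I" using assms(2) by blast
  have "\<exists>p q :: nat. 0 < p \<and> 0 < q \<and> real p * T a = real q * T i" if "i \<in> I" for i
    using positive_rational_multiple pos rat a that by blast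
  then obtain p q :: "nat \<Rightarrow> nat"
    where pq: "\<And>i. i \<in> I \<Longrightarrow> 0 < p i \<and> 0 < q i \<and> real (p i) * T a = real (q i) * T i"
    by metis
  define P where "P k \<longleftrightarrow> 0 < k \<and> common_multiple I T (real k * T a)" for k :: nat
  \<comment> \<open>Each \<open>p i * T a\<close> is a positive integer multiple of
    \<open>T i\<close>; the remaining factors of the product preserve this.\<close>
  have "P (\<Prod>i\<in>I. p i)"
    unfolding P_def common_multiple_def
  proof (intro conjI ballI)
    show "0 < prod p I" using pq by (simp add: prod_pos)
    then show "0 < real (prod p I) * T a" using pos[OF a] by (simp del: of_nat_prod)
    fix i assume i: "i \<in> I"
    let ?r = "prod p (I - {i})"
    have "0 < ?r" using pq by (intro prod_pos) auto
    have "prod p I = ?r * p i" using assms(1) i by (simp add: prod.remove mult.commute)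
    then have "real (prod p I) * T a = real ?r * (real (p i) * T a)"
      by (simp del: of_nat_prod)
    also have "\<dots> = real (?r * q i) * T i"
      using pq[OF i] by (simp del: of_nat_prod)
    finally show "\<exists>k::nat. 0 < k \<and> real (prod p I) * T a = real k * T i"
      using pq[OF i] \<open>0 < ?r\<close> by (intro exI[of _ "?r * q i"]) simp
  qed
  then have least: "P (LEAST k. P k)" by (rule LeastI)
  have "real (LEAST k. P k) * T a \<le> L'" if L': "common_multiple I T L'" for L'
  proof -
    obtain k :: nat where k: "0 < k" "L' = real k * T a"
      using L' a by (auto simp: common_multiple_def)
    then have "(LEAST k. P k) \<le> k" using L' by (intro Least_le) (simp add: P_def)
    then show ?thesis using k pos[OF a] by simp
  qed
  then show ?thesis using least unfolding least_common_multiple_def P_def by blast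
qed

section \<open>The wave speed oscillation as a sum of waves\<close>

definition wave_coeff ::
  "real \<Rightarrow> (complex \<Rightarrow> complex) \<Rightarrow> (real \<Rightarrow> real) \<Rightarrow> real \<Rightarrow> real \<Rightarrow> real \<Rightarrow> nat \<Rightarrow> complex" where
  "wave_coeff kv G ang A w \<phi> n =
     of_real (A * cmod (G (\<i> * of_real w)) ^ (n - 1)) *
     (of_real w + \<i> * of_real kv * (1 - of_real (cmod (G (\<i> * of_real w))) * cis (ang w))) *
     cis (\<phi> + real (n - 1) * ang w)"

text \<open>With \<open>\<theta>\<close> the phase of vehicle \<open>n - 1\<close>, the speed term
  is the real part of \<open>\<omega> m * cis \<theta>\<close> up to amplitude, and
  \<open>- sin \<theta>\<close> is that of \<open>\<i> * cis \<theta>\<close>. Passing to vehicle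
  \<open>n\<close> multiplies by \<open>r * cis \<alpha>\<close>, whence the factor
  \<open>1 - r * cis \<alpha>\<close> for the spacing.\<close>

lemma wave_speed_osc_eq_sum_waves:
  assumes "1 \<le> n"
  shows "wave_speed_osc kv G ang A \<omega> \<phi> I n t =
    (\<Sum>m\<in>I. Re (wave_coeff kv G ang (A m) (\<omega> m) (\<phi> m) n * cis (\<omega> m * t)))"
proof -
  obtain k where n: "n = Suc k" using assms by (cases n) auto
  have "A m * r ^ k * \<omega> m * cos (\<omega> m * t + \<phi> m + real k * \<alpha>) -
      kv * (A m * r ^ k * sin (\<omega> m * t + \<phi> m + real k * \<alpha>) -
        A m * r ^ Suc k * sin (\<omega> m * t + \<phi> m + real (Suc k) * \<alpha>)) =
      Re (of_real (A m * r ^ k) * (of_real (\<omega> m) + \<i> * of_real kv * (1 - of_real r * cis \<alpha>)) *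
        cis (\<phi> m + real k * \<alpha>) * cis (\<omega> m * t))" for m r \<alpha>
  proof -
    define \<theta> where "\<theta> = \<omega> m * t + \<phi> m + real k * \<alpha>"
    have 1: "\<omega> m * t + \<phi> m + real (Suc k) * \<alpha> = \<theta> + \<alpha>"
      by (simp add: \<theta>_def algebra_simps)
    have 2: "of_real (A m * r ^ k) * (of_real (\<omega> m) + \<i> * of_real kv * (1 - of_real r * cis \<alpha>)) *
        cis (\<phi> m + real k * \<alpha>) * cis (\<omega> m * t)
      = of_real (A m * r ^ k) * ((of_real (\<omega> m) + \<i> * of_real kv * (1 - of_real r * cis \<alpha>)) *
        cis \<theta>)"
      by (simp only: mult.assoc cis_mult \<theta>_def) (simp add: algebra_simps)
    show ?thesis
      unfolding 1 2 \<theta>_def[symmetric]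
      by (simp del: of_real_mult of_real_power add: sin_add) (simp add: algebra_simps)
  qed
  then show ?thesis
    unfolding wave_speed_osc_def wave_speed_def osc_position_def osc_velocity_def wave_coeff_def
      n diff_Suc_1
    by (simp only: sum_subtractf[symmetric] sum_distrib_left)
qed

section \<open>Nonvanishing of the wave coefficients\<close>

lemma gain_phase_factor_nonzero:
  assumes w: "0 < w" and ks: "0 < ks" and kv: "0 < kv" and \<tau>: "0 < \<tau>"
    and phase: "is_phase_shift ks kv \<tau> w \<alpha>"
    and r_def: "r = cmod (acc_transfer ks kv \<tau> (\<i> * of_real w))"
  shows "of_real w + \<i> * of_real kv * (1 - of_real r * cis \<alpha>) \<noteq> 0"
proof
  define a where "a = ks * \<tau> + kv"
  have a: "kv < a" "ks * \<tau> < a" unfolding a_def using assms by simp_all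
  assume "of_real w + \<i> * of_real kv * (1 - of_real r * cis \<alpha>) = 0"
  then have s: "kv * (r * sin \<alpha>) = - w" and c: "r * cos \<alpha> = 1"
    using kv by (auto simp: complex_eq_iff)
  let ?N = "ks * a + kv * w^2" and ?D = "w * (ks - kv * a)"
  have c0: "cos \<alpha> \<noteq> 0" using c by auto
  then have D0: "?D \<noteq> 0" and tan: "tan \<alpha> = ?N / ?D"
    using phase unfolding is_phase_shift_def Let_def a_def[symmetric] by (auto split: if_splits)
  have r0: "r \<noteq> 0" using c by auto
  have "sin \<alpha> * ?D = ?N * cos \<alpha>"
    using tan c0 D0 unfolding tan_def by (metis frac_eq_eq mult.commute)
  \<comment> \<open>Multiplying by \<open>kv * r\<close> lets \<open>s\<close> and \<open>c\<close>
    eliminate both the gain and the angle.\<close>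
  then have "kv * (r * sin \<alpha>) * ?D = kv * ?N * (r * cos \<alpha>)" by (simp add: mult_ac)
  then have "- w * ?D = kv * ?N" unfolding s c by simp
  then have "ks * (w^2 * (kv * \<tau> - 1)) = ks * (kv * a)"
    by (simp add: a_def power2_eq_square algebra_simps)
  then have "w^2 * (kv * \<tau> - 1) = kv * a" using ks by simp
  then have "kv * a < kv * (w^2 * \<tau>)" using w by (simp add: algebra_simps)
  then have "a < w^2 * \<tau>" using kv by simp
  then have "ks * \<tau> < w^2 * \<tau>" using a by linarith
  then have ks_less: "ks < w^2" using \<tau> by simp
  \<comment> \<open>The numerator of the squared gain has the factor \<open>a^2 + w^2\<close>, which
    cancels one of the two in the denominator.\<close>
  have r2: "r^2 * (w^2 * (a^2 + w^2)) = ks^2 + kv^2 * w^2"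
  proof -
    have pos: "0 < a^2 + w^2" using w by (simp add: add_nonneg_pos)
    have "r^2 = ((- ks + kv * a)^2 * w^2 + ?N^2) / (w * (a^2 + w^2))^2"
      unfolding r_def cmod_acc_transfer[OF w] a_def[symmetric] by (simp add: power_divide)
    also have "(- ks + kv * a)^2 * w^2 + ?N^2 = (ks^2 + kv^2 * w^2) * (a^2 + w^2)"
      by (simp add: power2_eq_square algebra_simps)
    finally show ?thesis using pos w by (simp add: power2_eq_square)
  qed
  \<comment> \<open>A second value of the squared gain, now from the assumed vanishing.\<close>
  have "kv^2 * r^2 = (kv * (r * sin \<alpha>))^2 + kv^2 * (r * cos \<alpha>)^2"
    by (simp only: power_mult_distrib flip: distrib_left) simp
  also have "\<dots> = w^2 + kv^2" unfolding s c by simp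
  finally have "(w^2 + kv^2) * (w^2 * (a^2 + w^2)) = kv^2 * (ks^2 + kv^2 * w^2)"
    using r2 by (metis mult.assoc)
  \<comment> \<open>Expanded, the right side of the last equation has the terms
    \<open>kv^2 * ks^2\<close> and \<open>kv^4 * w^2\<close>. Since \<open>ks < w^2\<close> and
    \<open>kv < a\<close>, they lie strictly below two terms of the left side, and what remains
    there is nonnegative.\<close>
  moreover have "kv^2 * ks^2 < kv^2 * (w^2)^2"
    using ks_less ks kv by (intro mult_strict_left_mono power_strict_mono) auto
  moreover have "kv^2 * w^2 * kv^2 < kv^2 * w^2 * a^2"
    using a w kv by (intro mult_strict_left_mono power_strict_mono) auto
  moreover have "0 \<le> w^2 * (w^2 * (a^2 + w^2))" by simp
  ultimately show False by (simp add: algebra_simps power2_eq_square)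
qed

lemma wave_coeff_nonzero:
  assumes "0 < w" "0 < ks" "0 < kv" "0 < \<tau>" "A \<noteq> 0"
    and "is_phase_shift ks kv \<tau> w (ang w)"
  shows "wave_coeff kv (acc_transfer ks kv \<tau>) ang A w \<phi> n \<noteq> 0"
proof -
  define r where "r = cmod (acc_transfer ks kv \<tau> (\<i> * of_real w))"
  \<comment> \<open>The second square under the root of the gain is positive, so neither the gain
    nor its power \<open>n - 1\<close> is zero.\<close>
  have "0 < (ks * (ks * \<tau> + kv) + kv * w^2)^2" "0 < (ks * \<tau> + kv)^2 + w^2"
    using assms by (simp_all add: add_pos_pos less_imp_neq[symmetric])
  then have "r \<noteq> 0"
    unfolding r_def cmod_acc_transfer[OF assms(1)] using assms(1)
    by (metis add_nonneg_pos divide_eq_0_iff less_irrefl mult_pos_pos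
        power_mult_distrib real_sqrt_eq_zero_cancel_iff zero_le_power2)
  moreover have "of_real w + \<i> * of_real kv * (1 - of_real r * cis (ang w)) \<noteq> 0"
    using gain_phase_factor_nonzero assms r_def by blast
  ultimately show ?thesis
    using assms(5) unfolding wave_coeff_def r_def[symmetric] by simp
qed

section \<open>Decomposition and period of the wave speed\<close>

lemma wave_speed_steady_oscillation:
  assumes "steady_oscillation G ang ve xe A \<omega> \<phi> I x v" "1 \<le> n"
  shows "wave_speed kv x v n t = (ve - kv * xe) + wave_speed_osc kv G ang A \<omega> \<phi> I n t"
proof -
  obtain k where n: "n = Suc k" using assms(2) by (cases n) auto
  have motion: "x i t = ve * t - real i * xe + osc_position G ang A \<omega> \<phi> I i t"
    "v i t = ve + osc_velocity G ang A \<omega> \<phi> I i t" for i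
    using assms(1) unfolding steady_oscillation_def by blast+
  \<comment> \<open>The ramps \<open>ve * t\<close> cancel in the spacing, and the offsets of
    vehicles \<open>k\<close> and \<open>Suc k\<close> differ by exactly \<open>xe\<close>.\<close>
  show ?thesis
    unfolding wave_speed_osc_def wave_speed_def n motion by (simp add: algebra_simps)
qed

theorem proposition2:
  fixes ks kv \<tau> ve xe :: real
    and M :: nat
    and A \<omega> \<phi> :: "nat \<Rightarrow> real"
    and G :: "complex \<Rightarrow> complex"
    and ang :: "real \<Rightarrow> real"
    and x v :: "nat \<Rightarrow> real \<Rightarrow> real"
    and xs vs :: "nat \<Rightarrow> nat \<Rightarrow> real \<Rightarrow> real"
  assumes "0 < ks" and "0 < kv" and "0 < \<tau>"
    and "1 \<le> M"
    and "\<And>m. m \<in> {1..M} \<Longrightarrow> 0 < \<omega> m"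
    and "G = acc_transfer ks kv \<tau>"
    and "\<And>m. m \<in> {1..M} \<Longrightarrow> is_phase_shift ks kv \<tau> (\<omega> m) (ang (\<omega> m))"
    and compounding: "steady_oscillation G ang ve xe A \<omega> \<phi> {1..M} x v"
    and single: "\<And>m. m \<in> {1..M} \<Longrightarrow> steady_oscillation G ang ve xe A \<omega> \<phi> {m} (xs m) (vs m)"
  shows "(\<forall>n\<ge>1. \<forall>t.
        wave_speed kv x v n t = (ve - kv * xe) + wave_speed_osc kv G ang A \<omega> \<phi> {1..M} n t \<and>
        (\<forall>m\<in>{1..M}. wave_speed kv (xs m) (vs m) n t =
           (ve - kv * xe) + wave_speed_osc kv G ang A \<omega> \<phi> {m} n t) \<and>
        wave_speed_osc kv G ang A \<omega> \<phi> {1..M} n t =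
          (\<Sum>m=1..M. wave_speed_osc kv G ang A \<omega> \<phi> {m} n t))
    \<and>
    (rationally_related {1..M} \<omega> \<longrightarrow>
      (\<exists>L. least_common_multiple {1..M} (\<lambda>m. 2 * pi / \<omega> m) L \<and>
        (\<forall>n\<ge>1. is_period (wave_speed_osc kv G ang A \<omega> \<phi> {1..M} n) L \<and>
          (inj_on \<omega> {1..M} \<and> (\<forall>m\<in>{1..M}. A m \<noteq> 0) \<longrightarrow>
            fundamental_period (wave_speed_osc kv G ang A \<omega> \<phi> {1..M} n) L))))"
proof (intro conjI impI allI ballI)
  fix n :: nat and t assume n: "1 \<le> n"
  show "wave_speed kv x v n t = (ve - kv * xe) + wave_speed_osc kv G ang A \<omega> \<phi> {1..M} n t"
    by (rule wave_speed_steady_oscillation[OF compounding n])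
  show "wave_speed_osc kv G ang A \<omega> \<phi> {1..M} n t =
      (\<Sum>m=1..M. wave_speed_osc kv G ang A \<omega> \<phi> {m} n t)"
    by (simp add: wave_speed_osc_eq_sum_waves[OF n])
  fix m assume "m \<in> {1..M}"
  from wave_speed_steady_oscillation[OF single[OF this] n]
  show "wave_speed kv (xs m) (vs m) n t =
      (ve - kv * xe) + wave_speed_osc kv G ang A \<omega> \<phi> {m} n t" .
next
  let ?T = "\<lambda>m. 2 * pi / \<omega> m"
  assume "rationally_related {1..M} \<omega>"
  \<comment> \<open>The ratio of two periods is the inverse ratio
    \<open>\<omega> j / \<omega> i\<close> of their frequencies.\<close>
  then have "?T i / ?T j \<in> \<rat>" if "i \<in> {1..M}" "j \<in> {1..M}" for i j
    using that unfolding rationally_related_def by simp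
  then obtain L where L: "least_common_multiple {1..M} ?T L"
    using least_common_multiple_exists[of "{1..M}" ?T] assms(4,5) by auto
  have "is_period (wave_speed_osc kv G ang A \<omega> \<phi> {1..M} n) L \<and>
      (inj_on \<omega> {1..M} \<and> (\<forall>m\<in>{1..M}. A m \<noteq> 0) \<longrightarrow>
        fundamental_period (wave_speed_osc kv G ang A \<omega> \<phi> {1..M} n) L)" if n: "1 \<le> n" for n
  proof -
    let ?c = "\<lambda>m. wave_coeff kv G ang (A m) (\<omega> m) (\<phi> m) n"
    have osc: "wave_speed_osc kv G ang A \<omega> \<phi> {1..M} n =
        (\<lambda>t. \<Sum>m\<in>{1..M}. Re (?c m * cis (\<omega> m * t)))"
      by (rule ext) (rule wave_speed_osc_eq_sum_waves[OF n])
    have per: "is_period (wave_speed_osc kv G ang A \<omega> \<phi> {1..M} n) L"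
      unfolding osc using L assms(5)
      by (intro is_period_sum_waves) (simp_all add: least_common_multiple_def)
    \<comment> \<open>Nonzero amplitudes keep every wave present and distinct frequencies keep waves
      from cancelling each other, so any period is a common multiple of the
      \<open>?T m\<close>.\<close>
    moreover have "L \<le> T'"
      if "inj_on \<omega> {1..M}" "\<forall>m\<in>{1..M}. A m \<noteq> 0"
        "is_period (wave_speed_osc kv G ang A \<omega> \<phi> {1..M} n) T'" for T'
    proof -
      have "?c m \<noteq> 0" if "m \<in> {1..M}" for m
        unfolding assms(6) using that assms(1-3,5,7) \<open>\<forall>m\<in>{1..M}. A m \<noteq> 0\<close>
        by (intro wave_coeff_nonzero) auto
      then have "common_multiple {1..M} ?T T'"
        using period_sum_waves_imp_common_multiple[of "{1..M}" \<omega> ?c T'] that assms(5)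
        unfolding osc by blast
      then show ?thesis using L by (simp add: least_common_multiple_def)
    qed
    ultimately show ?thesis unfolding fundamental_period_def by blast
  qed
  with L show "\<exists>L. least_common_multiple {1..M} ?T L \<and>
      (\<forall>n\<ge>1. is_period (wave_speed_osc kv G ang A \<omega> \<phi> {1..M} n) L \<and>
        (inj_on \<omega> {1..M} \<and> (\<forall>m\<in>{1..M}. A m \<noteq> 0) \<longrightarrow>
          fundamental_period (wave_speed_osc kv G ang A \<omega> \<phi> {1..M} n) L))"
    by blast
qed

end
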